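(* For any positive integers $k,t$ with $k\geq t+1$, there exists an integer $n_0=n_0(k,t)$ such that for all $n\geq n_0$ the following holds: if $\mathcal{A}\subseteq S_{n,k}$ is $t$-intersecting, then $$|\mathcal{A}|\leq \left[\begin{matrix} n-t\\ k-t\end{matrix}\right],$$ with equality if and only if $\mathcal{A}$ is the stabiliser of $t$ fixed points, i.e. $\mathcal{A}=\{\pi\in S_{n,k} : \pi(x)=x \text{ for all } x\in X\}$ for some $X\subseteq [n]$ with $|X|=t$.
   Context: Let $[n]=\{1,2,\dots,n\}$ and let $S_n$ be the set of permutations of $[n]$. For a positive integer $k$, $S_{n,k}$ is the set of permutations of $[n]$ whose disjoint cycle decomposition has exactly $k$ cycles, where fixed points count as cycles of length 1. For $\pi=c_1c_2\cdots c_k\in S_{n,k}$ with $c_1,\dots,c_k$ disjoint cycles, let $M(\pi)=\{c_1,\dots,c_k\}$ be its set of cycles (cycles are identified up to cyclic rotation of their entries). A family $\mathcal{A}\subseteq S_{n,k}$ is $t$-intersecting if $|M(\pi_1)\cap M(\pi_2)|\geq t$ for all $\pi_1,\pi_2\in\mathcal{A}$. The symbol $\left[\begin{matrix} n\\ k\end{matrix}\right]$ denotes the unsigned Stirling number of the first kind, which equals $|S_{n,k}|$. *)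

theory Defs
  imports "HOL-Combinatorics.Cycles" "HOL-Combinatorics.Stirling"
begin

text \<open>A cycle is the set of all rotations of a word, so fixed points yield the distinct
  cycles \<open>{[x]}\<close>. (Encoding cycles as functions would identify all the 1-cycles.)\<close>

definition rotation_class :: "'a list \<Rightarrow> 'a list set" where
  "rotation_class xs = {rotate i xs | i. True}"

text \<open>\<open>support p x\<close> is the word \<open>[x, p x, p (p x), \<dots>]\<close> running once through the
  cycle of \<open>p\<close> that contains \<open>x\<close>.\<close>

definition cycles :: "nat \<Rightarrow> (nat \<Rightarrow> nat) \<Rightarrow> nat list set set" where
  "cycles n p = {rotation_class (support p x) | x. x \<in> {1..n}}"

definition perms_with_cycles :: "nat \<Rightarrow> nat \<Rightarrow> (nat \<Rightarrow> nat) set" where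
  "perms_with_cycles n k = {p. p permutes {1..n} \<and> card (cycles n p) = k}"

definition t_intersecting :: "nat \<Rightarrow> nat \<Rightarrow> (nat \<Rightarrow> nat) set \<Rightarrow> bool" where
  "t_intersecting n t A \<longleftrightarrow> (\<forall>p\<in>A. \<forall>q\<in>A. card (cycles n p \<inter> cycles n q) \<ge> t)"

end

theory Submission
  imports Defs "HOL-Combinatorics.Orbits"
begin

text \<open>
  One fact about cycles reduces the theorem to counting: the cycle of \<open>p\<close> through \<open>x\<close> is a cycle of
  \<open>q\<close> exactly when \<open>p\<close> and \<open>q\<close> agree on the orbit of \<open>x\<close> (\<open>cycle_through_eq_iff\<close>). Hence the
  permutations containing a given set \<open>U\<close> of disjoint cycles are those prescribed on the points that
  \<open>U\<close> covers, and restricting them to the \<open>n - w\<close> uncovered points shows that those with \<open>k\<close> cycles number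
  \<open>stirling (n - w) (k - card U)\<close> (\<open>card_permutations_containing_cycles\<close>). Here \<open>w\<close> is at least
  \<open>card U\<close>, with equality only if all the cycles in \<open>U\<close> are fixed points.

  A \<open>t\<close>-intersecting family \<open>A\<close> is of one of two kinds.

  If \<open>t\<close> cycles are common to all members, the count just described bounds \<open>card A\<close> by
  \<open>stirling (n - w) (k - t)\<close> with \<open>w \<ge> t\<close>. Since \<open>stirling\<close> is monotone in its first argument, the
  bound claimed follows; since it is strictly monotone eventually, equality forces \<open>w = t\<close>, and then the
  common cycles are \<open>t\<close> fixed points and \<open>A\<close> is their whole stabiliser.

  If no \<open>t\<close> cycles are common to all members, every member contains one of at most
  \<open>(k choose t) * k\<close> sets of \<open>t + 1\<close> cycles (\<open>card_nontrivial_intersecting_le\<close>), so, up to a factor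
  depending on \<open>k\<close> and \<open>t\<close> only, \<open>card A\<close> is at most \<open>stirling (n - t - 1) (k - t - 1) + 1\<close>. For large
  \<open>n\<close> this is smaller than \<open>stirling (n - t) (k - t)\<close>, because \<open>stirling m j\<close> is at most a constant
  times \<open>stirling m (j + 1)\<close>, while the recursion for \<open>stirling (m + 1) (j + 1)\<close> multiplies the latter by
  \<open>m\<close> (\<open>mult_stirling_less\<close>). So a family of the second kind never attains the bound.
\<close>

section \<open>Cycles of a permutation\<close>

definition cycle_through :: "('a \<Rightarrow> 'a) \<Rightarrow> 'a \<Rightarrow> 'a list set" where
  "cycle_through p x = rotation_class (support p x)"

lemma cycles_eq_image: "cycles n p = cycle_through p ` {1..n}"
  by (auto simp: cycles_def cycle_through_def)

lemma set_support_eq_orbit: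
  assumes "permutation p"
  shows "set (support p x) = orbit p x"
  using support_set[OF assms, of x] orbit_altdef_permutation[OF assms, of x] by auto

lemma map_support:
  assumes "permutation p"
  shows "map p (support p x) = rotate1 (support p x)"
proof -
  obtain m where m: "least_power p x = Suc m"
    using least_power_of_permutation(2)[OF assms, of x] by (cases "least_power p x") auto
  have "(p ^^ Suc m) x = x"
    using least_power_of_permutation(1)[OF assms, of x] m by simp
  then have "map p (support p x) = map (\<lambda>i. (p ^^ Suc i) x) [0..<m] @ [x]"
    by (simp add: m)
  moreover have "support p x = x # map (\<lambda>i. (p ^^ Suc i) x) [0..<m]"
    unfolding m upt_conv_Cons[OF zero_less_Suc] map_Suc_upt[symmetric] by simp
  ultimately show ?thesis by simp
qed

lemma support_step:
  assumes "permutation p"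
  shows "support p (p x) = rotate1 (support p x)"
proof -
  have "inj p" using assms by (simp add: permutation bij_is_inj)
  then have "(p ^^ n) (p x) = p x \<longleftrightarrow> (p ^^ n) x = x" for n
    by (metis funpow_swap1 injD)
  then have "least_power p (p x) = least_power p x"
    by (simp add: least_power_def)
  moreover have "map p (support p x) = map (\<lambda>i. (p ^^ i) (p x)) [0..<least_power p x]"
    by (simp add: funpow_swap1)
  ultimately show ?thesis
    using map_support[OF assms, of x] by (simp only:)
qed

lemma support_funpow:
  assumes "permutation p"
  shows "support p ((p ^^ i) x) = rotate i (support p x)"
  by (induction i) (use support_step[OF assms] in \<open>simp_all del: map_map\<close>)

lemma cycle_through_eq_if_in_orbit:
  assumes p: "permutation p" and y: "y \<in> orbit p x"
  shows "cycle_through p x = cycle_through p y"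
proof -
  have sub: "cycle_through p v \<subseteq> cycle_through p u" if "v \<in> orbit p u" for u v
  proof -
    have "v \<in> {(p ^^ i) u | i. True}"
      using that unfolding orbit_altdef_permutation[OF p] .
    then obtain i where v: "v = (p ^^ i) u" by blast
    have "rotate j (support p v) = rotate (j + i) (support p u)" for j
      unfolding v support_funpow[OF p] by (rule rotate_rotate)
    then show ?thesis
      unfolding cycle_through_def rotation_class_def by blast
  qed
  have "x \<in> orbit p y"
    using orbit_swap[OF permutation_self_in_orbit[OF p] y] .
  then show ?thesis using sub y by blast
qed

lemma cycle_through_cong:
  assumes "\<And>z. z \<in> orbit p x \<Longrightarrow> p z = q z" and "permutation p"
  shows "cycle_through p x = cycle_through q x"
proof -
  have "(p ^^ i) x = (q ^^ i) x" for i
  proof (induction i)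
    case (Suc i)
    have "(p ^^ i) x \<in> orbit p x"
      using orbit_altdef_permutation[OF assms(2), of x] by auto
    then show ?case using Suc assms(1) by auto
  qed simp
  then show ?thesis
    by (simp add: cycle_through_def least_power_def)
qed

text \<open>Equal cycles force agreement because a word \<open>ys\<close> that runs through a cycle of \<open>q\<close> satisfies
  \<open>map q ys = rotate1 ys\<close>, and so does every rotation of it. If \<open>ys\<close> is also a rotation of a word running
  through a cycle of \<open>p\<close>, then \<open>map p ys = rotate1 ys = map q ys\<close>, and \<open>p\<close> and \<open>q\<close> agree on \<open>set ys\<close>.\<close>

lemma cycle_through_eq_iff:
  assumes p: "permutation p" and q: "permutation q"
  shows "cycle_through p x = cycle_through q y \<longleftrightarrow>
    y \<in> orbit p x \<and> (\<forall>z\<in>orbit p x. p z = q z)"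
proof
  assume eq: "cycle_through p x = cycle_through q y"
  have "support q y \<in> cycle_through q y"
    unfolding cycle_through_def rotation_class_def by (intro CollectI exI[of _ 0]) simp
  then have "\<exists>i. support q y = rotate i (support p x)"
    unfolding eq[symmetric] unfolding cycle_through_def rotation_class_def by simp
  then obtain i where i: "support q y = rotate i (support p x)" by blast
  have orb: "orbit q y = orbit p x"
    using arg_cong[OF i, of set] by (simp only: set_rotate set_support_eq_orbit[OF p] set_support_eq_orbit[OF q])
  have "map q (support q y) = rotate1 (rotate i (support p x))"
    unfolding map_support[OF q] unfolding i ..
  also have "\<dots> = rotate i (map p (support p x))"
    unfolding map_support[OF p] by (rule rotate1_rotate_swap)
  also have "\<dots> = map p (support q y)"
    unfolding i by (rule rotate_map)
  finally have "\<forall>z\<in>set (support q y). q z = p z"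
    by (simp only: map_eq_conv)
  then show "y \<in> orbit p x \<and> (\<forall>z\<in>orbit p x. p z = q z)"
    unfolding set_support_eq_orbit[OF q] orb
    using orb permutation_self_in_orbit[OF q, of y] by auto
next
  assume R: "y \<in> orbit p x \<and> (\<forall>z\<in>orbit p x. p z = q z)"
  then have "cycle_through p x = cycle_through q x"
    using cycle_through_cong[of p x q] p by blast
  moreover have "orbit q x = orbit p x"
    using R orbit_cong[OF permutation_self_in_orbit[OF p], of x q] by auto
  ultimately show "cycle_through p x = cycle_through q y"
    using cycle_through_eq_if_in_orbit[OF q] R by auto
qed

lemma cycle_through_eq_iff_orbit_eq:
  assumes p: "permutation p"
  shows "cycle_through p x = cycle_through p y \<longleftrightarrow> orbit p x = orbit p y"
proof -
  have "y \<in> orbit p x \<longleftrightarrow> orbit p x = orbit p y"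
    using orbit_cyclic_eq3[OF cyclic_on_orbit'[OF p]] permutation_self_in_orbit[OF p] by metis
  then show ?thesis using cycle_through_eq_iff[OF p p] by simp
qed


section \<open>Stirling numbers count permutations by cycles\<close>

text \<open>This allows cycles to be counted as orbits, and the orbits of one permutation to be matched with
  those of another, without an explicit bijection between them.\<close>

lemma card_image_eq_if_same_kernel:
  assumes "\<And>x y. x \<in> S \<Longrightarrow> y \<in> S \<Longrightarrow> f x = f y \<longleftrightarrow> g x = g y"
  shows "card (f ` S) = card (g ` S)"
proof (rule bij_betw_same_card)
  show "bij_betw (\<lambda>c. g (inv_into S f c)) (f ` S) (g ` S)"
  proof (rule bij_betw_imageI)
    show "inj_on (\<lambda>c. g (inv_into S f c)) (f ` S)"
      using assms by (intro inj_onI) (metis f_inv_into_f inv_into_into)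
    have "g (inv_into S f (f x)) = g x" if "x \<in> S" for x
      using assms that by (metis f_inv_into_f imageI inv_into_into)
    then show "(\<lambda>c. g (inv_into S f c)) ` f ` S = g ` S"
      by (auto simp: image_image)
  qed
qed

definition num_cycles :: "'a set \<Rightarrow> ('a \<Rightarrow> 'a) \<Rightarrow> nat" where
  "num_cycles S p = card (cycle_through p ` S)"

lemma num_cycles_eq_card_orbits:
  assumes "permutation p"
  shows "num_cycles S p = card (orbit p ` S)"
  unfolding num_cycles_def
  by (rule card_image_eq_if_same_kernel) (simp add: cycle_through_eq_iff_orbit_eq[OF assms])

lemma num_cycles_insert_fixed_point:
  assumes q: "q permutes S" and S: "finite S" and a: "a \<notin> S"
  shows "num_cycles (insert a S) q = Suc (num_cycles S q)"
proof -
  have perm: "permutation q" using q S by (auto simp: permutation_permutes)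
  have "q a = a" using q a by (rule permutes_not_in)
  then have "orbit q a = {a}" by (simp add: orbit_eq_singleton_iff)
  moreover have "orbit q x \<noteq> {a}" if "x \<in> S" for x
    using permutes_orbit_subset[OF q that] a by auto
  ultimately have "orbit q a \<notin> orbit q ` S" by (metis imageE)
  then show ?thesis
    using S by (simp add: num_cycles_eq_card_orbits[OF perm])
qed

text \<open>Composing \<open>q\<close> with the transposition of a new point \<open>a\<close> and \<open>b \<in> S\<close> inserts \<open>a\<close> just before
  \<open>b\<close> in the cycle of \<open>b\<close>; every other cycle is unchanged, so no cycle is created or lost.\<close>

lemma num_cycles_insert_into_cycle:
  assumes q: "q permutes S" and S: "finite S" and a: "a \<notin> S" and b: "b \<in> S"
  shows "num_cycles (insert a S) (transpose a b \<circ> q) = num_cycles S q"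
proof -
  define p where "p = transpose a b \<circ> q"
  have ab: "a \<noteq> b" using a b by auto
  have qa: "q a = a" using q a by (rule permutes_not_in)
  have p_a: "p a = b" by (simp add: p_def qa)
  have p_b: "p z = a" if "q z = b" for z using that by (simp add: p_def)
  have p_other: "p z = q z" if "z \<in> S" "q z \<noteq> b" for z
  proof -
    have "q z \<noteq> a" using that a permutes_in_image[OF q] by metis
    then show ?thesis using that by (simp add: p_def)
  qed
  have perm_q: "permutation q" using q S by (auto simp: permutation_permutes)
  have perm_p: "permutation p"
    unfolding p_def by (rule permutation_compose[OF permutation_swap_id perm_q])
  have to_p: "y \<in> orbit p x" if "x \<in> S" "y \<in> orbit q x" for x y
    using that(2)
  proof induction
    case base
    show ?case
    proof (cases "q x = b")
      case True
      then have "p (p x) = b" using p_a p_b by simp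
      then show ?thesis using True by (metis orbit.intros)
    qed (use that p_other orbit.base in metis)
  next
    case (step y)
    then have "y \<in> S" using permutes_orbit_subset[OF q \<open>x \<in> S\<close>] by blast
    show ?case
    proof (cases "q y = b")
      case True
      then have "p (p y) = b" using p_a p_b by simp
      then show ?thesis using True step by (metis orbit.intros)
    qed (use step \<open>y \<in> S\<close> p_other orbit.step in metis)
  qed
  have from_p: "(if y = a then b else y) \<in> orbit q x" if "x \<in> S" "y \<in> orbit p x" for x y
    using that(2)
  proof induction
    case base
    show ?case
    proof (cases "q x = b")
      case True
      then show ?thesis using p_b orbit.base[of q x] by simp
    next
      case False
      moreover have "q x \<noteq> a" using \<open>x \<in> S\<close> a permutes_in_image[OF q] by metis
      ultimately show ?thesis using p_other[OF \<open>x \<in> S\<close>] orbit.base[of q x] by simp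
    qed
  next
    case (step y)
    show ?case
    proof (cases "y = a")
      case True
      then show ?thesis using step p_a ab by simp
    next
      case False
      then have y: "y \<in> orbit q x" using step by simp
      then have "y \<in> S" using permutes_orbit_subset[OF q \<open>x \<in> S\<close>] by blast
      then have "q y \<noteq> a" using a permutes_in_image[OF q] by metis
      then show ?thesis
        using p_b[of y] p_other[OF \<open>y \<in> S\<close>] orbit.step[OF y] by (cases "q y = b") auto
    qed
  qed
  have orbit_eq_iff: "orbit r x = orbit r y \<longleftrightarrow> y \<in> orbit r x"
    if "permutation r" for r :: "'a \<Rightarrow> 'a" and x y
    using orbit_cyclic_eq3[OF cyclic_on_orbit'[OF that]] permutation_self_in_orbit[OF that] by metis
  \<comment> \<open>on \<open>S\<close> the two permutations have the same orbits\<close>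
  have kernel: "orbit p x = orbit p y \<longleftrightarrow> orbit q x = orbit q y" if "x \<in> S" "y \<in> S" for x y
    unfolding orbit_eq_iff[OF perm_p] orbit_eq_iff[OF perm_q]
    using to_p[OF that(1), of y] from_p[OF that(1), of y] that a by (auto split: if_splits)
  have "orbit p a = orbit p b"
    using permutation_orbit_step[OF perm_p, of a] p_a by simp
  then have "orbit p ` insert a S = orbit p ` S" using b by auto
  then have "num_cycles (insert a S) p = card (orbit p ` S)"
    by (simp add: num_cycles_eq_card_orbits[OF perm_p])
  also have "\<dots> = card (orbit q ` S)"
    by (rule card_image_eq_if_same_kernel) (rule kernel)
  finally show ?thesis
    by (simp add: num_cycles_eq_card_orbits[OF perm_q] p_def)
qed

text \<open>A permutation of \<open>insert a S\<close> is \<open>transpose a b \<circ> q\<close> for a unique \<open>b\<close>, the image of \<open>a\<close>, and a unique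
  permutation \<open>q\<close> of \<open>S\<close>. The \<open>card S\<close> choices \<open>b \<in> S\<close> keep the number of cycles of \<open>q\<close> and \<open>b = a\<close> adds
  one, which is the recursion of the Stirling numbers.\<close>

theorem card_permutations_with_num_cycles:
  assumes "finite S"
  shows "card {p. p permutes S \<and> num_cycles S p = k} = stirling (card S) k"
  using assms
proof (induction S arbitrary: k rule: finite_induct)
  case empty
  have "{p. p permutes {} \<and> num_cycles {} p = k} = (if k = 0 then {id :: 'a \<Rightarrow> 'a} else {})"
    by (auto simp: num_cycles_def)
  then show ?case by (cases k) auto
next
  case (insert a S)
  define E where "E j = {q. q permutes S \<and> num_cycles S q = j}" for j
  have card_E: "card (E j) = stirling (card S) j" for j
    using insert.IH by (simp add: E_def)
  have fin_E: "finite (E j)" for j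
    using finite_permutations[OF insert.hyps(1)] by (rule rev_finite_subset) (auto simp: E_def)
  \<comment> \<open>the permutations that map \<open>a\<close> to \<open>b \<in> S\<close>, and those that fix \<open>a\<close>\<close>
  define F where "F b = (\<lambda>q. transpose a b \<circ> q) ` E k" for b
  define G where "G = (if k = 0 then {} else E (k - 1))"
  have at_a: "(transpose a b \<circ> q) a = b" if "q \<in> E j" for b q j
  proof -
    have "q a = a" using that insert.hyps(2) by (auto simp: E_def intro: permutes_not_in)
    then show ?thesis by simp
  qed
  have split: "{p. p permutes insert a S \<and> num_cycles (insert a S) p = k} = (\<Union>b\<in>S. F b) \<union> G"
  proof (intro set_eqI iffI)
    fix p assume "p \<in> {p. p permutes insert a S \<and> num_cycles (insert a S) p = k}"
    then have p: "p permutes insert a S" and k: "num_cycles (insert a S) p = k" by auto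
    have "p \<in> {p. p permutes insert a S}" using p by simp
    then obtain b q where bq: "p = transpose a b \<circ> q" "b \<in> insert a S" "q permutes S"
      unfolding permutes_insert by (elim imageE) auto
    show "p \<in> (\<Union>b\<in>S. F b) \<union> G"
    proof (cases "b = a")
      case True
      then have "p = q" using bq by simp
      then have "k = Suc (num_cycles S q)"
        using k num_cycles_insert_fixed_point[OF bq(3) insert.hyps] by simp
      then show ?thesis using \<open>p = q\<close> bq by (simp add: G_def E_def)
    next
      case False
      then have b: "b \<in> S" using bq by simp
      have "num_cycles S q = k"
        using k num_cycles_insert_into_cycle[OF bq(3) insert.hyps b] bq(1) by simp
      then show ?thesis using b bq unfolding F_def E_def by blast
    qed
  next
    fix p assume "p \<in> (\<Union>b\<in>S. F b) \<union> G"
    then consider (F) b q where "b \<in> S" "p = transpose a b \<circ> q" "q \<in> E k" | (G) "p \<in> G"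
      unfolding F_def by blast
    then show "p \<in> {p. p permutes insert a S \<and> num_cycles (insert a S) p = k}"
    proof cases
      case F
      then have q: "q permutes S" "num_cycles S q = k" by (auto simp: E_def)
      have "p permutes insert a S"
        using permutes_compose[OF permutes_subset[OF q(1)] permutes_swap_id] F by blast
      then show ?thesis
        using num_cycles_insert_into_cycle[OF q(1) insert.hyps F(1)] q F by simp
    next
      case G
      then have q: "p permutes S" "Suc (num_cycles S p) = k"
        by (auto simp: G_def E_def split: if_splits)
      then show ?thesis
        using num_cycles_insert_fixed_point[OF q(1) insert.hyps] permutes_subset[OF q(1), of "insert a S"]
        by auto
    qed
  qed
  have fin_F: "finite (F b)" for b using fin_E by (simp add: F_def)
  have card_F: "card (F b) = stirling (card S) k" for b
  proof -
    have "inj_on (\<lambda>q. transpose a b \<circ> q) (E k)"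
      by (rule inj_onI) (metis comp_assoc comp_id fun.map_id transpose_comp_involutory id_comp)
    then show ?thesis by (simp add: F_def card_image card_E)
  qed
  have F_at: "p a = b" if "p \<in> F b" for p b
    using that at_a by (auto simp: F_def)
  have G_at: "p a = a" if "p \<in> G" for p
    using that at_a[of p _ a] by (auto simp: G_def split: if_splits)
  have fin_G: "finite G" by (simp add: G_def fin_E)
  have "(\<Union>b\<in>S. F b) \<inter> G = {}"
    using F_at G_at insert.hyps(2) by fastforce
  then have "card ((\<Union>b\<in>S. F b) \<union> G) = card (\<Union>b\<in>S. F b) + card G"
    using fin_F fin_G insert.hyps(1) by (intro card_Un_disjoint) auto
  also have "card (\<Union>b\<in>S. F b) = (\<Sum>b\<in>S. card (F b))"
    using insert.hyps(1) fin_F F_at by (intro card_UN_disjoint) blast+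
  finally have "card {p. p permutes insert a S \<and> num_cycles (insert a S) p = k}
    = card S * stirling (card S) k + card G"
    unfolding split by (simp add: card_F)
  also have "\<dots> = stirling (card (insert a S)) k"
    using insert.hyps by (cases k) (cases "card S"; auto simp: G_def card_E)+
  finally show ?case .
qed

lemma orbit_subset_invariant:
  assumes "x \<in> W" and "\<And>z. z \<in> W \<Longrightarrow> p z \<in> W"
  shows "orbit p x \<subseteq> W"
proof
  fix y assume "y \<in> orbit p x"
  then show "y \<in> W" by induction (use assms in auto)
qed

lemma num_cycles_cong:
  assumes "permutation p" and "\<And>z. z \<in> W \<Longrightarrow> p z \<in> W" and "\<And>z. z \<in> W \<Longrightarrow> q z = p z"
  shows "num_cycles W q = num_cycles W p"
proof -
  have "cycle_through p x = cycle_through q x" if "x \<in> W" for x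
    using orbit_subset_invariant[of x W p, OF that assms(2)] assms(3)
    by (intro cycle_through_cong[OF _ assms(1)]) auto
  then show ?thesis by (simp add: num_cycles_def)
qed

lemma num_cycles_split_invariant:
  assumes q: "permutation q" and S: "finite S" and W: "W \<subseteq> S" "\<And>z. z \<in> W \<Longrightarrow> q z \<in> W"
  shows "num_cycles S q = num_cycles W q + num_cycles (S - W) q"
proof -
  have "cycle_through q x \<noteq> cycle_through q y" if "x \<in> W" "y \<in> S - W" for x y
    using orbit_subset_invariant[of x W q, OF that(1) W(2)] that(2) cycle_through_eq_iff[OF q q, of x y] by blast
  then have "cycle_through q ` W \<inter> cycle_through q ` (S - W) = {}" by blast
  moreover have "cycle_through q ` S = cycle_through q ` W \<union> cycle_through q ` (S - W)"
    using W(1) by blast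
  ultimately show ?thesis
    using S W(1) finite_subset[OF W(1) S] by (simp add: num_cycles_def card_Un_disjoint)
qed

text \<open>Restricting to \<open>S - W\<close> is a bijection from the permutations that extend \<open>p\<close> on \<open>W\<close> to those of
  \<open>S - W\<close>. No cycle meets both \<open>W\<close> and \<open>S - W\<close>, so the cycles inside \<open>W\<close> are those of \<open>p\<close> and the other \<open>j\<close>
  are the cycles of the restriction.\<close>

theorem card_permutations_prescribed_on_invariant_set:
  fixes p :: "'a \<Rightarrow> 'a"
  assumes S: "finite S" and p: "p permutes S" and W: "W \<subseteq> S" "\<And>z. z \<in> W \<Longrightarrow> p z \<in> W"
  shows "card {q. q permutes S \<and> (\<forall>x\<in>W. q x = p x) \<and> num_cycles S q = num_cycles W p + j}
    = stirling (card S - card W) j"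
    (is "card ?L = _")
proof -
  define R where "R = {r. r permutes (S - W) \<and> num_cycles (S - W) r = j}"
  define g where "g = (\<lambda>q. restrict_id q (S - W))"
  define h where "h = (\<lambda>r :: 'a \<Rightarrow> 'a. restrict_id p W \<circ> r)"
  have perm: "permutation q" if "q permutes S" for q
    using that S by (auto simp: permutation_permutes)
  have finW: "finite W" using W(1) S by (rule finite_subset)
  have bij_W: "bij_betw q W W" if "q permutes S" "\<And>z. z \<in> W \<Longrightarrow> q z \<in> W" for q
    using endo_inj_surj[OF finW _ permutes_inj_on[OF that(1)]] permutes_inj_on[OF that(1)] that(2)
    unfolding bij_betw_def by blast
  have g: "g q \<in> R" "h (g q) = q" if "q \<in> ?L" for q
  proof -
    have q: "q permutes S" "\<And>x. x \<in> W \<Longrightarrow> q x = p x" "num_cycles S q = num_cycles W p + j"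
      using that by auto
    have qW: "q z \<in> W" if "z \<in> W" for z using q(2) W(2) that by simp
    have "q ` (S - W) = S - W"
      using bij_W[OF q(1) qW] permutes_image[OF q(1)] permutes_inj[OF q(1)]
      by (simp add: image_set_diff bij_betw_def)
    then have bij: "bij_betw q (S - W) (S - W)"
      using permutes_inj_on[OF q(1)] by (simp add: bij_betw_def)
    then have stay: "q z \<in> S - W" if "z \<in> S - W" for z
      using that by (rule bij_betwE[rule_format])
    have "num_cycles W q = num_cycles W p"
      using num_cycles_cong[OF perm[OF p] W(2)] q(2) by blast
    moreover have "num_cycles (S - W) (g q) = num_cycles (S - W) q"
      using stay by (intro num_cycles_cong[OF perm[OF q(1)]]) (auto simp: g_def)
    ultimately have "num_cycles (S - W) (g q) = j"
      using num_cycles_split_invariant[OF perm[OF q(1)] S W(1) qW] q(3) by simp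
    then show "g q \<in> R"
      using permutes_restrict_id[OF bij] by (simp add: R_def g_def)
    have "h (g q) z = q z" for z
      using q(2)[of z] stay[of z] permutes_not_in[OF q(1), of z] W(1)
      by (cases "z \<in> W"; cases "z \<in> S") (auto simp: g_def h_def restrict_id_def)
    then show "h (g q) = q" by blast
  qed
  have h: "h r \<in> ?L" "g (h r) = r" if "r \<in> R" for r
  proof -
    have r: "r permutes (S - W)" "num_cycles (S - W) r = j" using that by (auto simp: R_def)
    have rW: "r z = z" if "z \<notin> S - W" for z using r(1) that by (rule permutes_not_in)
    have stay: "r z \<in> S - W" if "z \<in> S - W" for z
      using that permutes_in_image[OF r(1)] by blast
    have on_W: "h r z = p z" if "z \<in> W" for z
      using that rW by (simp add: h_def)
    have off_W: "h r z = r z" if "z \<notin> W" for z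
      using that rW[of z] stay[of z] by (cases "z \<in> S - W") (auto simp: h_def restrict_id_def)
    have "restrict_id p W permutes S"
      using permutes_subset[OF permutes_restrict_id[OF bij_W[OF p W(2)]] W(1)] .
    moreover have "r permutes S" using permutes_subset[OF r(1)] by blast
    ultimately have hS: "h r permutes S" unfolding h_def by (intro permutes_compose)
    have hW: "h r z \<in> W" if "z \<in> W" for z using on_W W(2) that by simp
    have "num_cycles W (h r) = num_cycles W p"
      using num_cycles_cong[OF perm[OF p] W(2)] on_W by blast
    moreover have "num_cycles (S - W) (h r) = num_cycles (S - W) r"
      using stay off_W \<open>r permutes S\<close> by (intro num_cycles_cong perm) auto
    ultimately show "h r \<in> ?L"
      using num_cycles_split_invariant[OF perm[OF hS] S W(1) hW] r(2) hS on_W by simp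
    have "g (h r) z = r z" for z
      using off_W[of z] rW[of z] by (cases "z \<in> S - W") (auto simp: g_def restrict_id_def)
    then show "g (h r) = r" by blast
  qed
  have "bij_betw g ?L R"
    by (rule bij_betw_byWitness[where f' = h]) (use g h in auto)
  then have "card ?L = card R" by (rule bij_betw_same_card)
  also have "\<dots> = stirling (card (S - W)) j"
    unfolding R_def using S by (intro card_permutations_with_num_cycles) simp
  finally show ?thesis using W(1) finW by (simp add: card_Diff_subset)
qed

text \<open>The condition of containing the cycles in \<open>U\<close> becomes a condition on the values at the set \<open>W\<close> of
  points that these cycles cover, which is invariant under \<open>p\<close>.\<close>

lemma prescribed_cycles:
  assumes S: "finite S" and p: "p permutes S" and U: "U \<subseteq> cycle_through p ` S"
  defines "W \<equiv> {x \<in> S. cycle_through p x \<in> U}"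
  shows "cycle_through p ` W = U"
    and "\<And>x. x \<in> W \<Longrightarrow> p x \<in> W"
    and "\<And>q. q permutes S \<Longrightarrow> U \<subseteq> cycle_through q ` S \<longleftrightarrow> (\<forall>x\<in>W. q x = p x)"
proof -
  have perm: "permutation q" if "q permutes S" for q
    using that S by (auto simp: permutation_permutes)
  show img: "cycle_through p ` W = U" using U by (auto simp: W_def)
  show inv: "p x \<in> W" if "x \<in> W" for x
    using that permutes_in_image[OF p] cycle_through_eq_if_in_orbit[OF perm[OF p] orbit.base, of x]
    by (auto simp: W_def)
  show "U \<subseteq> cycle_through q ` S \<longleftrightarrow> (\<forall>x\<in>W. q x = p x)" if q: "q permutes S" for q
  proof
    assume sub: "U \<subseteq> cycle_through q ` S"
    show "\<forall>x\<in>W. q x = p x"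
    proof
      fix x assume "x \<in> W"
      then obtain y where "cycle_through p x = cycle_through q y" using sub by (auto simp: W_def)
      then show "q x = p x"
        using cycle_through_eq_iff[OF perm[OF p] perm[OF q]] permutation_self_in_orbit[OF perm[OF p], of x]
        by metis
    qed
  next
    assume agree: "\<forall>x\<in>W. q x = p x"
    have "cycle_through p x = cycle_through q x" if "x \<in> W" for x
      using orbit_subset_invariant[of x W p, OF that inv] agree
      by (intro cycle_through_cong[OF _ perm[OF p]]) auto
    then have "U = cycle_through q ` W" using img by auto
    then show "U \<subseteq> cycle_through q ` S" by (auto simp: W_def)
  qed
qed

theorem card_permutations_containing_cycles:
  assumes S: "finite S" and p: "p permutes S" and U: "U \<subseteq> cycle_through p ` S"
  shows "card {q. q permutes S \<and> num_cycles S q = card U + j \<and> U \<subseteq> cycle_through q ` S}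
    = stirling (card S - card {x \<in> S. cycle_through p x \<in> U}) j"
proof -
  define W where "W = {x \<in> S. cycle_through p x \<in> U}"
  note W = prescribed_cycles[OF S p U, folded W_def]
  have "{q. q permutes S \<and> num_cycles S q = card U + j \<and> U \<subseteq> cycle_through q ` S}
      = {q. q permutes S \<and> (\<forall>x\<in>W. q x = p x) \<and> num_cycles S q = num_cycles W p + j}"
    using W(1) W(3) unfolding num_cycles_def by blast
  then show ?thesis
    using card_permutations_prescribed_on_invariant_set[OF S p _ W(2), of j]
    by (simp add: W_def)
qed

lemma card_le_card_support:
  assumes "finite S" and "U \<subseteq> cycle_through p ` S"
  shows "card U \<le> card {x \<in> S. cycle_through p x \<in> U}"
proof -
  have "U = cycle_through p ` {x \<in> S. cycle_through p x \<in> U}" using assms(2) by auto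
  then show ?thesis using card_image_le[of "{x \<in> S. cycle_through p x \<in> U}" "cycle_through p"] assms(1) by simp
qed

text \<open>If the cycles in \<open>U\<close> cover only \<open>card U\<close> points, each of them covers a single point; but \<open>x\<close> and
  \<open>p x\<close> are covered by the same cycle.\<close>

lemma fixed_if_card_support_eq:
  assumes S: "finite S" and p: "p permutes S" and U: "U \<subseteq> cycle_through p ` S"
    and card: "card {x \<in> S. cycle_through p x \<in> U} = card U"
    and x: "x \<in> S" "cycle_through p x \<in> U"
  shows "p x = x"
proof -
  define W where "W = {x \<in> S. cycle_through p x \<in> U}"
  note W = prescribed_cycles[OF S p U, folded W_def]
  have "finite W" using S by (simp add: W_def)
  then have "inj_on (cycle_through p) W"
    using W(1) card by (intro eq_card_imp_inj_on) (auto simp: W_def)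
  moreover have "permutation p" using p S by (auto simp: permutation_permutes)
  then have "cycle_through p x = cycle_through p (p x)"
    by (intro cycle_through_eq_if_in_orbit orbit.base)
  moreover have "x \<in> W" using x by (simp add: W_def)
  ultimately show ?thesis using W(2) by (metis inj_onD)
qed


section \<open>Growth of the Stirling numbers\<close>

lemma stirling_pos:
  assumes "j \<le> m"
  shows "stirling (Suc m) (Suc j) > 0"
  using assms
proof (induction m arbitrary: j)
  case (Suc m)
  then show ?case by (cases j) auto
qed simp

text \<open>The positive second argument matters: \<open>stirling 0 0 = 1\<close>, but \<open>stirling 1 0 = 0\<close>.\<close>

lemma stirling_Suc_mono: "m \<le> n \<Longrightarrow> stirling m (Suc j) \<le> stirling n (Suc j)"
proof (induction rule: dec_induct)
  case (step n)
  have "stirling n (Suc j) \<le> stirling (Suc n) (Suc j)" by (cases n) auto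
  then show ?case using step.IH by simp
qed simp

text \<open>The hypothesis \<open>2 \<le> m\<close> is sharp: \<open>stirling 1 1 = stirling 2 1 = 1\<close>.\<close>

lemma stirling_strict_mono_step:
  assumes "2 \<le> m" and "j \<le> m"
  shows "stirling m (Suc j) < stirling (Suc m) (Suc j)"
proof (cases "j = m")
  case False
  then obtain l where l: "m = Suc l" "j \<le> l" using assms by (cases m) auto
  have "stirling m (Suc j) > 0" unfolding l(1) using l(2) by (rule stirling_pos)
  then have "1 * stirling m (Suc j) < m * stirling m (Suc j)"
    using assms(1) by (intro mult_strict_right_mono) auto
  then have "stirling m (Suc j) < m * stirling m (Suc j) + stirling m j" by linarith
  then show ?thesis by simp
qed simp

text \<open>The constant comes from the base case \<open>m = j + 1\<close> of the induction, where
  \<open>stirling (j + 1) j = (j + 1) choose 2\<close>. In the induction step the recursions of both sides are compared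
  term by term, which works because the constant is increasing in \<open>j\<close>.\<close>

lemma stirling_le_Suc_choose_two_mult:
  "Suc j \<le> m \<Longrightarrow> stirling m j \<le> (Suc j choose 2) * stirling m (Suc j)"
proof (induction m arbitrary: j)
  case (Suc m)
  show ?case
  proof (cases j)
    case (Suc i)
    show ?thesis
    proof (cases "m = j")
      case True
      then show ?thesis by (simp only: stirling_Suc_n_n stirling_same mult_1_right order_refl)
    next
      case False
      then have le: "Suc j \<le> m" "Suc i \<le> m" using Suc.prems Suc by auto
      define K where "K = (Suc j choose 2)"
      have "(Suc i choose 2) \<le> K" unfolding K_def Suc by (simp add: numeral_2_eq_2)
      then have "(Suc i choose 2) * stirling m j \<le> K * stirling m j" by (rule mult_le_mono1)
      then have "stirling m i \<le> K * stirling m j"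
        using Suc.IH[OF le(2)] unfolding Suc by linarith
      moreover have "m * stirling m j \<le> m * (K * stirling m (Suc j))"
        using Suc.IH[OF le(1)] unfolding K_def by (rule mult_le_mono2)
      ultimately have "m * stirling m j + stirling m i \<le> K * (m * stirling m (Suc j) + stirling m j)"
        unfolding distrib_left mult.left_commute[of m K] by linarith
      then show ?thesis unfolding K_def by (simp add: Suc)
    qed
  qed simp
qed simp

lemma mult_stirling_less:
  assumes "C * ((Suc j choose 2) + 1) + j + 1 \<le> m"
  shows "C * (stirling m j + 1) < stirling (Suc m) (Suc j)"
proof -
  define K where "K = (Suc j choose 2)"
  have jm: "Suc j \<le> m" using assms by simp
  obtain l where l: "m = Suc l" "j \<le> l" using jm by (cases m) auto
  have pos: "stirling m (Suc j) > 0" unfolding l(1) using l(2) by (rule stirling_pos)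
  have "stirling m j + 1 \<le> (K + 1) * stirling m (Suc j)"
    using stirling_le_Suc_choose_two_mult[OF jm] pos unfolding K_def by (simp add: add_mult_distrib)
  then have "C * (stirling m j + 1) \<le> C * ((K + 1) * stirling m (Suc j))" by (rule mult_le_mono2)
  also have "\<dots> = (C * (K + 1)) * stirling m (Suc j)" by (simp only: mult.assoc)
  also have "\<dots> < m * stirling m (Suc j)"
    using assms pos unfolding K_def by (intro mult_strict_right_mono) auto
  also have "\<dots> \<le> stirling (Suc m) (Suc j)" by simp
  finally show ?thesis .
qed


section \<open>Nontrivial intersecting families are small\<close>

text \<open>Fix a member \<open>p\<close>. Any member \<open>q\<close> contains some \<open>T \<subseteq> M p\<close> with \<open>t\<close> elements, and there is a member
  \<open>r\<close>, depending on \<open>T\<close> only, that does not contain \<open>T\<close>. As \<open>q\<close> and \<open>r\<close> share at least \<open>t\<close> elements, \<open>q\<close>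
  also contains an element of \<open>M r - T\<close>. So \<open>q\<close> contains one of at most \<open>(k choose t) * k\<close> sets
  with \<open>t + 1\<close> elements.\<close>

lemma card_nontrivial_intersecting_le:
  fixes M :: "'a \<Rightarrow> 'b set"
  assumes A: "finite A" and card_M: "\<And>q. q \<in> A \<Longrightarrow> finite (M q) \<and> card (M q) = k"
    and inter: "\<And>p q. p \<in> A \<Longrightarrow> q \<in> A \<Longrightarrow> t \<le> card (M p \<inter> M q)"
    and nontriv: "\<And>T. card T = t \<Longrightarrow> \<exists>q\<in>A. \<not> T \<subseteq> M q"
    and D: "\<And>U. card U = Suc t \<Longrightarrow> card {q \<in> A. U \<subseteq> M q} \<le> D"
  shows "card A \<le> (k choose t) * (k * D)"
proof (cases "A = {}")
  case False
  then obtain p where p: "p \<in> A" by blast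
  define r where "r T = (SOME q. q \<in> A \<and> \<not> T \<subseteq> M q)" for T
  have r: "r T \<in> A" "\<not> T \<subseteq> M (r T)" if "card T = t" for T
    using nontriv[OF that] someI_ex[of "\<lambda>q. q \<in> A \<and> \<not> T \<subseteq> M q"] unfolding r_def by blast+
  define \<T> where "\<T> = {T. T \<subseteq> M p \<and> card T = t}"
  define B where "B T = (\<Union>c\<in>M (r T) - T. {q \<in> A. insert c T \<subseteq> M q})" for T
  have fin_\<T>: "finite \<T>"
    unfolding \<T>_def using card_M[OF p] by simp
  have card_\<T>: "card \<T> = (k choose t)"
    unfolding \<T>_def using n_subsets[of "M p" t] card_M[OF p] by simp
  have "A \<subseteq> (\<Union>T\<in>\<T>. B T)"
  proof
    fix q assume q: "q \<in> A"
    obtain T where T: "T \<subseteq> M p \<inter> M q" "card T = t"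
      using obtain_subset_with_card_n[OF inter[OF p q]] by blast
    have finT: "finite T" using T card_M[OF q] finite_subset by blast
    have "\<not> M q \<inter> M (r T) \<subseteq> T"
    proof
      assume sub: "M q \<inter> M (r T) \<subseteq> T"
      then have "M q \<inter> M (r T) = T"
        using card_seteq[OF finT sub] inter[OF q r(1)[OF T(2)]] T(2) by simp
      then show False using r(2)[OF T(2)] by blast
    qed
    then have "q \<in> B T" using T q unfolding B_def by blast
    then show "q \<in> (\<Union>T\<in>\<T>. B T)" using T by (auto simp: \<T>_def)
  qed
  moreover have "card (B T) \<le> k * D" if "T \<in> \<T>" for T
  proof -
    have T: "card T = t" "finite T"
      using that card_M[OF p] finite_subset by (auto simp: \<T>_def)
    have fin: "finite (M (r T) - T)" using card_M[OF r(1)[OF T(1)]] by simp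
    have "card (B T) \<le> (\<Sum>c\<in>M (r T) - T. card {q \<in> A. insert c T \<subseteq> M q})"
      unfolding B_def using fin by (rule card_UN_le)
    also have "\<dots> \<le> card (M (r T) - T) * D"
    proof -
      have "card {q \<in> A. insert c T \<subseteq> M q} \<le> D" if "c \<in> M (r T) - T" for c
        using that T by (intro D) simp
      then show ?thesis using sum_bounded_above[of "M (r T) - T" _ D] by simp
    qed
    also have "\<dots> \<le> k * D"
      using card_M[OF r(1)[OF T(1)]] by (intro mult_le_mono1) (metis Diff_subset card_mono)
    finally show ?thesis .
  qed
  moreover have "finite (\<Union>T\<in>\<T>. B T)"
    using fin_\<T> A by (rule_tac finite_subset[OF _ A]) (auto simp: B_def)
  ultimately have "card A \<le> card (\<Union>T\<in>\<T>. B T)" by (intro card_mono)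
  also have "\<dots> \<le> (\<Sum>T\<in>\<T>. card (B T))" using fin_\<T> by (rule card_UN_le)
  also have "\<dots> \<le> card \<T> * (k * D)"
    using \<open>\<And>T. T \<in> \<T> \<Longrightarrow> card (B T) \<le> k * D\<close>
    by (intro sum_bounded_above[where K = "k * D", simplified]) auto
  finally show ?thesis by (simp add: card_\<T>)
qed simp


section \<open>Intersecting families of permutations with a given number of cycles\<close>

lemma perms_with_cycles_eq:
  "perms_with_cycles n k = {q. q permutes {1..n} \<and> num_cycles {1..n} q = k}"
  by (simp add: perms_with_cycles_def cycles_eq_image num_cycles_def)

lemma finite_perms_with_cycles: "finite (perms_with_cycles n k)"
  by (rule finite_subset[OF _ finite_permutations[of "{1..n}"]]) (auto simp: perms_with_cycles_def)

lemma card_stabiliser: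
  assumes X: "X \<subseteq> {1..n}" and "card X \<le> k"
  shows "card {p \<in> perms_with_cycles n k. \<forall>x\<in>X. p x = x} = stirling (n - card X) (k - card X)"
proof -
  have "permutation (id :: nat \<Rightarrow> nat)" by simp
  moreover have "orbit id x = {x}" for x :: nat by (simp add: orbit_eq_singleton_iff)
  ultimately have "num_cycles X id = card X"
    by (simp add: num_cycles_eq_card_orbits card_image)
  then show ?thesis
    using card_permutations_prescribed_on_invariant_set[of "{1..n}" id X "k - card X"] assms
    by (simp add: perms_with_cycles_eq conj_ac)
qed

lemma trivial_family_bound:
  assumes A: "A \<subseteq> perms_with_cycles n k" "A \<noteq> {}" and T: "card T = t" "\<And>q. q \<in> A \<Longrightarrow> T \<subseteq> cycles n q"
    and k: "t + 1 \<le> k" and n: "t + 3 \<le> n" "k \<le> n"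
  shows "card A \<le> stirling (n - t) (k - t)"
    and "card A = stirling (n - t) (k - t) \<Longrightarrow>
      \<exists>X. X \<subseteq> {1..n} \<and> card X = t \<and> A = {p \<in> perms_with_cycles n k. \<forall>x\<in>X. p x = x}"
proof -
  obtain p where pA: "p \<in> A" using A(2) by blast
  then have p: "p permutes {1..n}" using A(1) by (auto simp: perms_with_cycles_def)
  have Tp: "T \<subseteq> cycle_through p ` {1..n}" using T(2)[OF pA] by (simp add: cycles_eq_image)
  define W where "W = {x \<in> {1..n}. cycle_through p x \<in> T}"
  define E where "E = {q \<in> perms_with_cycles n k. T \<subseteq> cycles n q}"
  obtain j where j: "k - t = Suc j" using k by (cases "k - t") auto
  have "E = {q. q permutes {1..n} \<and> num_cycles {1..n} q = card T + (k - t) \<and> T \<subseteq> cycle_through q ` {1..n}}"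
    using k T(1) by (auto simp: E_def perms_with_cycles_eq cycles_eq_image)
  then have card_E: "card E = stirling (n - card W) (k - t)"
    using card_permutations_containing_cycles[OF _ p Tp, of "k - t"] by (simp add: W_def)
  have "A \<subseteq> E" using A(1) T(2) by (auto simp: E_def)
  have "finite E" using finite_perms_with_cycles by (simp add: E_def)
  have A_le: "card A \<le> stirling (n - card W) (k - t)"
    using card_mono[OF \<open>finite E\<close> \<open>A \<subseteq> E\<close>] card_E by simp
  have tW: "t \<le> card W"
    using card_le_card_support[OF _ Tp] T(1) by (simp add: W_def)
  show "card A \<le> stirling (n - t) (k - t)"
    using A_le stirling_Suc_mono[OF diff_le_mono2[OF tW], of n j] unfolding j by (rule order_trans)
  assume eq: "card A = stirling (n - t) (k - t)"
  have W_t: "card W = t"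
  proof (rule ccontr)
    assume "card W \<noteq> t"
    then have "n - card W \<le> n - t - 1" using tW by simp
    then have "stirling (n - card W) (k - t) \<le> stirling (n - t - 1) (k - t)"
      unfolding j by (rule stirling_Suc_mono)
    also have "\<dots> < stirling (Suc (n - t - 1)) (k - t)"
      unfolding j using n j by (intro stirling_strict_mono_step) auto
    finally show False using A_le eq n by (simp add: Suc_diff_Suc)
  qed
  then have fixed: "p x = x" if "x \<in> W" for x
    using fixed_if_card_support_eq[OF _ p Tp, of x] that T(1) by (simp add: W_def)
  have "A = E"
    using card_subset_eq[OF \<open>finite E\<close> \<open>A \<subseteq> E\<close>] card_E eq W_t by simp
  also have "\<dots> = {q \<in> perms_with_cycles n k. \<forall>x\<in>W. q x = x}"
    using prescribed_cycles(3)[OF _ p Tp, folded W_def] fixed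
    by (auto simp: E_def perms_with_cycles_eq cycles_eq_image)
  finally show "\<exists>X. X \<subseteq> {1..n} \<and> card X = t \<and> A = {p \<in> perms_with_cycles n k. \<forall>x\<in>X. p x = x}"
    using W_t by (intro exI[of _ W]) (auto simp: W_def)
qed

text \<open>The summand 1 is needed when \<open>u = k\<close> and \<open>U\<close> covers all of \<open>{1..n}\<close>: then one permutation contains
  \<open>U\<close>, although \<open>stirling (n - u) 0 = 0\<close> if \<open>u < n\<close>.\<close>

lemma card_containing_cycles_le:
  assumes U: "card U = u" and k: "u \<le> k"
  shows "card {q \<in> perms_with_cycles n k. U \<subseteq> cycles n q} \<le> stirling (n - u) (k - u) + 1"
proof (cases "\<exists>p \<in> perms_with_cycles n k. U \<subseteq> cycles n p")
  case True
  then obtain p where p: "p permutes {1..n}" and Up: "U \<subseteq> cycle_through p ` {1..n}"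
    by (auto simp: perms_with_cycles_def cycles_eq_image)
  define w where "w = card {x \<in> {1..n}. cycle_through p x \<in> U}"
  have "u \<le> w" using card_le_card_support[OF _ Up] U by (simp add: w_def)
  have "{q \<in> perms_with_cycles n k. U \<subseteq> cycles n q}
      = {q. q permutes {1..n} \<and> num_cycles {1..n} q = card U + (k - u) \<and> U \<subseteq> cycle_through q ` {1..n}}"
    using k U by (auto simp: perms_with_cycles_eq cycles_eq_image)
  then have "card {q \<in> perms_with_cycles n k. U \<subseteq> cycles n q} = stirling (n - w) (k - u)"
    using card_permutations_containing_cycles[OF _ p Up, of "k - u"] by (simp add: w_def)
  also have "\<dots> \<le> stirling (n - u) (k - u) + 1"
  proof (cases "k - u")
    case 0
    then show ?thesis by (cases "n - w") auto
  next
    case (Suc j)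
    show ?thesis
      using stirling_Suc_mono[OF diff_le_mono2[OF \<open>u \<le> w\<close>], of n j] unfolding Suc by (rule trans_le_add1)
  qed
  finally show ?thesis .
next
  case False
  then have "{q \<in> perms_with_cycles n k. U \<subseteq> cycles n q} = {}" by blast
  then show ?thesis by (simp only: card.empty)
qed

text \<open>The abstract bound applied to the sets of cycles: each \<open>t + 1\<close> cycles lie in few permutations.\<close>

lemma nontrivial_family_bound:
  assumes A: "A \<subseteq> perms_with_cycles n k" "t_intersecting n t A"
    and nontriv: "\<And>T. card T = t \<Longrightarrow> \<exists>q\<in>A. \<not> T \<subseteq> cycles n q" and k: "t + 1 \<le> k"
  shows "card A \<le> (k choose t) * k * (stirling (n - t - 1) (k - t - 1) + 1)"
proof -
  have "card A \<le> (k choose t) * (k * (stirling (n - t - 1) (k - t - 1) + 1))"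
  proof (rule card_nontrivial_intersecting_le[where M = "cycles n" and t = t])
    show "finite A" using A(1) finite_perms_with_cycles by (rule finite_subset)
    show "finite (cycles n q) \<and> card (cycles n q) = k" if "q \<in> A" for q
      using that A(1) by (auto simp: perms_with_cycles_def cycles_eq_image)
    show "t \<le> card (cycles n p \<inter> cycles n q)" if "p \<in> A" "q \<in> A" for p q
      using that A(2) by (simp add: t_intersecting_def)
    show "\<exists>q\<in>A. \<not> T \<subseteq> cycles n q" if "card T = t" for T using nontriv that by blast
    show "card {q \<in> A. U \<subseteq> cycles n q} \<le> stirling (n - t - 1) (k - t - 1) + 1"
      if "card U = Suc t" for U
    proof -
      have "card {q \<in> A. U \<subseteq> cycles n q} \<le> card {q \<in> perms_with_cycles n k. U \<subseteq> cycles n q}"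
        using A(1) finite_perms_with_cycles by (intro card_mono) auto
      also have "\<dots> \<le> stirling (n - Suc t) (k - Suc t) + 1"
        using card_containing_cycles_le[OF that] k by simp
      finally show ?thesis by simp
    qed
  qed
  then show ?thesis by (simp only: mult.assoc)
qed

theorem theorem1p2:
  fixes k t :: nat
  assumes "k \<ge> 1" and "t \<ge> 1" and "k \<ge> t + 1"
  shows "\<exists>n0::nat. \<forall>n\<ge>n0. \<forall>A.
    A \<subseteq> perms_with_cycles n k \<and> t_intersecting n t A \<longrightarrow>
      card A \<le> stirling (n - t) (k - t) \<and>
      (card A = stirling (n - t) (k - t) \<longleftrightarrow>
        (\<exists>X. X \<subseteq> {1..n} \<and> card X = t \<and>
             A = {p \<in> perms_with_cycles n k. \<forall>x\<in>X. p x = x}))"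
proof -
  define j where "j = k - t - 1"
  define C where "C = (k choose t) * k"
  \<comment> \<open>\<open>k + t + 3\<close> suffices if \<open>t\<close> cycles are common to \<open>A\<close>; the rest is for \<open>mult_stirling_less\<close>\<close>
  define n0 where "n0 = k + t + 3 + C * ((Suc j choose 2) + 1) + j"
  have "card A \<le> stirling (n - t) (k - t) \<and>
      (card A = stirling (n - t) (k - t) \<longleftrightarrow>
        (\<exists>X. X \<subseteq> {1..n} \<and> card X = t \<and>
             A = {p \<in> perms_with_cycles n k. \<forall>x\<in>X. p x = x}))"
    if n: "n0 \<le> n" and A: "A \<subseteq> perms_with_cycles n k" "t_intersecting n t A" for n A
  proof -
    have stab: "card A = stirling (n - t) (k - t)"
      if "\<exists>X. X \<subseteq> {1..n} \<and> card X = t \<and> A = {p \<in> perms_with_cycles n k. \<forall>x\<in>X. p x = x}"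
      using that card_stabiliser[of _ n k] assms(3) by auto
    show ?thesis
    proof (cases "A \<noteq> {} \<and> (\<exists>T. card T = t \<and> (\<forall>q\<in>A. T \<subseteq> cycles n q))")
      case True
      then obtain T where T: "card T = t" "\<And>q. q \<in> A \<Longrightarrow> T \<subseteq> cycles n q" and ne: "A \<noteq> {}" by blast
      have "t + 3 \<le> n" "k \<le> n" using n by (auto simp: n0_def)
      note bound = trivial_family_bound[OF A(1) ne T assms(3) this]
      show ?thesis using bound stab by blast
    next
      case False
      have Suc_n: "Suc (n - t - 1) = n - t" using n by (simp add: n0_def)
      have Suc_k: "Suc j = k - t" using assms(3) by (simp add: j_def)
      have "card A \<le> C * (stirling (n - t - 1) j + 1)"
      proof (cases "A = {}")
        case False
        with \<open>\<not> (A \<noteq> {} \<and> _)\<close> show ?thesis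
          unfolding C_def j_def using nontrivial_family_bound[OF A _ assms(3)] by blast
      qed simp
      also have "\<dots> < stirling (Suc (n - t - 1)) (Suc j)"
        using n by (intro mult_stirling_less) (simp add: n0_def)
      finally have "card A < stirling (n - t) (k - t)" unfolding Suc_n Suc_k .
      then have "card A \<le> stirling (n - t) (k - t)" "card A \<noteq> stirling (n - t) (k - t)"
        by simp_all
      then show ?thesis using stab by blast
    qed
  qed
  then show ?thesis by (intro exI[of _ n0]) blast
qed

end
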